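(* Let $E$ be a locally convex vector space whose topology is generated by an increasing sequence of seminorms $(p_n)_{n\in\mathbb N}$. Let $A,B\subseteq\mathcal G_E$ be internal with representatives $(A_\varepsilon)_\varepsilon$, resp. $(B_\varepsilon)_\varepsilon$. (1) $[(A_\varepsilon\cap B_\varepsilon)_\varepsilon]\subseteq A\cap B$. The internal set $[(A_\varepsilon\cap B_\varepsilon)_\varepsilon]$ depends (in general) on the choice of the representatives $(A_\varepsilon)_\varepsilon$ of $A$ and $(B_\varepsilon)_\varepsilon$ of $B$. (2) Independently of the chosen representatives, $$A\cap B=\bigcap_{m\in\mathbb N}\big[\big(\{u\in E:d_m(u,A_\varepsilon)\le\varepsilon^m\}\cap\{u\in E:d_m(u,B_\varepsilon)\le\varepsilon^m\}\big)_\varepsilon\big].$$ (3) If $A\cap B$ is internal and has a sharply bounded representative, then there are representatives $(A_\varepsilon)_\varepsilon$ of $A$ and $(B_\varepsilon)_\varepsilon$ of $B$ such that $[(A_\varepsilon\cap B_\varepsilon)_\varepsilon]=A\cap B$.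
   Context: For a locally convex space $E$ with topology generated by seminorms $(p_i)_{i\in I}$: a net $(u_\varepsilon)_\varepsilon\in E^{(0,1)}$ is moderate if for each $i\in I$ there are $M\in\mathbb N$ and $\eta\in(0,1)$ with $p_i(u_\varepsilon)\le\varepsilon^{-M}$ for all $\varepsilon\le\eta$; it is negligible if for each $i\in I$ and each $m\in\mathbb N$ there is $\eta\in(0,1)$ with $p_i(u_\varepsilon)\le\varepsilon^m$ for all $\varepsilon\le\eta$. The Colombeau space based on $E$ is the quotient $\mathcal G_E$ of the moderate nets by the negligible nets; a net in the class $u\in\mathcal G_E$ is called a representative of $u$. For $C\subseteq E$ and $u\in E$, $d_n(u,C)=\inf_{v\in C}p_n(u-v)$, with $\inf\emptyset=+\infty$. A subset $A\subseteq\mathcal G_E$ is internal if there is a net $(A_\varepsilon)_{\varepsilon\in(0,1)}$ of subsets of $E$ (called a representative of $A$) such that $A=[(A_\varepsilon)_\varepsilon]$, the set of all $u\in\mathcal G_E$ for which there exist a representative $(u_\varepsilon)_\varepsilon$ of $u$ and $\eta>0$ such that $u_\varepsilon\in A_\varepsilon$ for all $\varepsilon<\eta$. A net $(A_\varepsilon)_\varepsilon$ of subsets of $E$ is sharply bounded if for each $i\in I$ there are $M\in\mathbb N$ and $\varepsilon_0\in(0,1)$ such that $p_i(u)\le\varepsilon^{-M}$ for all $\varepsilon\le\varepsilon_0$ and all $u\in A_\varepsilon$. The second sentence of (1) means: there exist a locally convex vector space $E$ whose topology is generated by an increasing sequence of seminorms $(p_n)_{n\in\mathbb N}$, internal sets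 $A,B\subseteq\mathcal G_E$, and two choices of representatives of $A$ and $B$ for which the sets $[(A_\varepsilon\cap B_\varepsilon)_\varepsilon]$ are different. *)

theory Defs
  imports Complex_Main "HOL-Library.Extended_Real"
begin

(* A locally convex space is given by a vector space together with a family of seminorms p
   generating its topology; every notion below refers to the topology only through p.
   By the Gelfand-Mazur theorem, the scalars of sort real_normed_field are exactly (isometric
   copies of) the real and the complex field. *)

definition seminorm :: "('k::real_normed_field \<Rightarrow> 'e::ab_group_add \<Rightarrow> 'e) \<Rightarrow> ('e \<Rightarrow> real) \<Rightarrow> bool"
  where "seminorm scale q \<longleftrightarrow>
    (\<forall>x. 0 \<le> q x) \<and>
    (\<forall>x y. q (x + y) \<le> q x + q y) \<and>
    (\<forall>c x. q (scale c x) = norm c * q x)"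

definition locally_convex_incseq ::
  "('k::real_normed_field \<Rightarrow> 'e::ab_group_add \<Rightarrow> 'e) \<Rightarrow> (nat \<Rightarrow> 'e \<Rightarrow> real) \<Rightarrow> bool"
  where "locally_convex_incseq scale p \<longleftrightarrow>
    vector_space scale \<and> (\<forall>n. seminorm scale (p n)) \<and> incseq p"

definition separating :: "('i \<Rightarrow> 'e::zero \<Rightarrow> real) \<Rightarrow> bool"
  where "separating p \<longleftrightarrow> (\<forall>x. (\<forall>i. p i x = 0) \<longrightarrow> x = 0)"

(* Nets indexed by (0,1) are represented by total functions on the reals. Their values outside
   (0,1) are never inspected: nets that agree on (0,1) lie in the same class, and the same
   internal set is represented by nets of subsets that agree on (0,1). *)

definition moderate_nets :: "('i \<Rightarrow> 'e \<Rightarrow> real) \<Rightarrow> (real \<Rightarrow> 'e) set"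
  where "moderate_nets p =
    {u. \<forall>i. \<exists>M::nat. \<exists>\<eta>\<in>{0<..<1}. \<forall>\<epsilon>\<in>{0<..\<eta>}. p i (u \<epsilon>) \<le> 1 / \<epsilon> ^ M}"

definition negligible_nets :: "('i \<Rightarrow> 'e \<Rightarrow> real) \<Rightarrow> (real \<Rightarrow> 'e) set"
  where "negligible_nets p =
    {u. \<forall>i. \<forall>m::nat. \<exists>\<eta>\<in>{0<..<1}. \<forall>\<epsilon>\<in>{0<..\<eta>}. p i (u \<epsilon>) \<le> \<epsilon> ^ m}"

definition colombeau_rel :: "('i \<Rightarrow> 'e::ab_group_add \<Rightarrow> real) \<Rightarrow> ((real \<Rightarrow> 'e) \<times> (real \<Rightarrow> 'e)) set"
  where "colombeau_rel p =
    {(u, v). u \<in> moderate_nets p \<and> v \<in> moderate_nets p \<and> (\<lambda>\<epsilon>. u \<epsilon> - v \<epsilon>) \<in> negligible_nets p}"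

(* The representatives of a point of the Colombeau space are its elements. *)
definition colombeau_space :: "('i \<Rightarrow> 'e::ab_group_add \<Rightarrow> real) \<Rightarrow> (real \<Rightarrow> 'e) set set"
  where "colombeau_space p = moderate_nets p // colombeau_rel p"

(* The set [(A\<^sub>\<epsilon>)\<^sub>\<epsilon>]. *)
definition internal_set ::
  "('i \<Rightarrow> 'e::ab_group_add \<Rightarrow> real) \<Rightarrow> (real \<Rightarrow> 'e set) \<Rightarrow> (real \<Rightarrow> 'e) set set"
  where "internal_set p S =
    {U \<in> colombeau_space p. \<exists>u\<in>U. \<exists>\<eta>>0. \<forall>\<epsilon>\<in>{0<..<1}. \<epsilon> < \<eta> \<longrightarrow> u \<epsilon> \<in> S \<epsilon>}"

definition represents ::
  "('i \<Rightarrow> 'e::ab_group_add \<Rightarrow> real) \<Rightarrow> (real \<Rightarrow> 'e set) \<Rightarrow> (real \<Rightarrow> 'e) set set \<Rightarrow> bool"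
  where "represents p S A \<longleftrightarrow> A = internal_set p S"

definition internal :: "('i \<Rightarrow> 'e::ab_group_add \<Rightarrow> real) \<Rightarrow> (real \<Rightarrow> 'e) set set \<Rightarrow> bool"
  where "internal p A \<longleftrightarrow> A \<subseteq> colombeau_space p \<and> (\<exists>S. represents p S A)"

definition sharply_bounded :: "('i \<Rightarrow> 'e \<Rightarrow> real) \<Rightarrow> (real \<Rightarrow> 'e set) \<Rightarrow> bool"
  where "sharply_bounded p S \<longleftrightarrow>
    (\<forall>i. \<exists>M::nat. \<exists>\<epsilon>\<^sub>0\<in>{0<..<1}. \<forall>\<epsilon>\<in>{0<..\<epsilon>\<^sub>0}. \<forall>u\<in>S \<epsilon>. p i u \<le> 1 / \<epsilon> ^ M)"

(* In the extended reals the infimum over the empty set is \<infinity>. *)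
definition seminorm_dist :: "('i \<Rightarrow> 'e::ab_group_add \<Rightarrow> real) \<Rightarrow> 'i \<Rightarrow> 'e \<Rightarrow> 'e set \<Rightarrow> ereal"
  where "seminorm_dist p i u C = (INF v\<in>C. ereal (p i (u - v)))"

end

theory Submission
  imports Defs
begin

text \<open>
  Everything rests on one criterion: the class of a moderate net \<open>u\<close> lies in the internal set of
  \<open>(S\<^sub>\<epsilon>)\<close> as soon as, for every order \<open>m\<close>, the point \<open>u\<^sub>\<epsilon>\<close> is eventually within \<open>\<epsilon>\<^sup>m\<close> of \<open>S\<^sub>\<epsilon>\<close> in
  the seminorm \<open>p\<^sub>m\<close>. Each order provides its own approximating points, and the task is to
  merge these countably many choices into one net. Since the seminorms increase, approximation of
  order \<open>m\<close> implies approximation of every lower order, so it suffices to use at each \<open>\<epsilon>\<close> the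
  highest order that is available there; this order tends to infinity as \<open>\<epsilon> \<rightarrow> 0\<close>
  (\<open>class_in_internal_set_if_approximable\<close>).

  The formula for \<open>A \<inter> B\<close> follows, because membership in the set of order \<open>m\<close> bounds the
  distance to both \<open>A\<^sub>\<epsilon>\<close> and \<open>B\<^sub>\<epsilon>\<close>, up to a negligible change of representative. Naive intersection
  fails because the two representatives may be separated by a negligible amount: \<open>{0}\<close> and
  \<open>{n\<^sub>\<epsilon>}\<close> with \<open>n\<close> negligible and nonzero represent the same point but are disjoint.

  To make the naive intersection correct, enlarge both representatives by a representative \<open>(C\<^sub>\<epsilon>)\<close> of
  \<open>A \<inter> B\<close>. A net with values in \<open>A\<^sub>\<epsilon> \<union> C\<^sub>\<epsilon>\<close> may alternate between the two sets, but its part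
  in \<open>C\<^sub>\<epsilon>\<close> can be completed, using any net in \<open>C\<^sub>\<epsilon>\<close>, to a point of \<open>A \<inter> B \<subseteq> A\<close>, and so it can be
  replaced by a net in \<open>A\<^sub>\<epsilon>\<close>. Hence the enlarged sets still represent \<open>A\<close> and \<open>B\<close>
  (\<open>internal_set_absorb\<close>). Only when \<open>A \<inter> B\<close> is empty is there no such net to complete with, and
  then the original representatives do.
\<close>

section \<open>Moderate and negligible nets\<close>

text \<open>
  Sufficiently small \<open>\<epsilon>\<close> is spelled out with open intervals for internal sets and with
  half-closed ones for nets. Both mean the filter of right neighbourhoods of \<open>0\<close>, where finitely
  many such conditions combine without bookkeeping of thresholds.
\<close>

lemma eventually_at_right_0_iff:
  "eventually P (at_right (0::real)) \<longleftrightarrow> (\<exists>\<eta>>0. \<forall>\<epsilon>\<in>{0<..<1}. \<epsilon> < \<eta> \<longrightarrow> P \<epsilon>)"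
proof
  assume "\<exists>\<eta>>0. \<forall>\<epsilon>\<in>{0<..<1}. \<epsilon> < \<eta> \<longrightarrow> P \<epsilon>"
  then obtain \<eta> where "\<eta> > 0" and \<eta>: "\<forall>\<epsilon>\<in>{0<..<1}. \<epsilon> < \<eta> \<longrightarrow> P \<epsilon>" by blast
  then have "min \<eta> 1 > 0" and "\<forall>\<epsilon>>0. \<epsilon> < min \<eta> 1 \<longrightarrow> P \<epsilon>" by auto
  then show "eventually P (at_right 0)" unfolding eventually_at_right_field by blast
qed (auto simp: eventually_at_right_field)

lemma eventually_at_right_0_iff_closed:
  "eventually P (at_right (0::real)) \<longleftrightarrow> (\<exists>\<eta>\<in>{0<..<1}. \<forall>\<epsilon>\<in>{0<..\<eta>}. P \<epsilon>)"
proof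
  assume "eventually P (at_right 0)"
  then obtain b where "b > 0" and b: "\<And>\<epsilon>. 0 < \<epsilon> \<Longrightarrow> \<epsilon> < b \<Longrightarrow> P \<epsilon>"
    unfolding eventually_at_right_field by blast
  then have "min b 1 / 2 \<in> {0<..<1}" and "\<forall>\<epsilon>\<in>{0<..min b 1 / 2}. P \<epsilon>" by auto
  then show "\<exists>\<eta>\<in>{0<..<1}. \<forall>\<epsilon>\<in>{0<..\<eta>}. P \<epsilon>" by blast
next
  assume "\<exists>\<eta>\<in>{0<..<1}. \<forall>\<epsilon>\<in>{0<..\<eta>}. P \<epsilon>"
  then show "eventually P (at_right 0)"
    unfolding eventually_at_right_field by (auto intro: less_imp_le)
qed

lemma moderate_nets_iff:
  "u \<in> moderate_nets p \<longleftrightarrow> (\<forall>i. \<exists>M::nat. \<forall>\<^sub>F \<epsilon> in at_right 0. p i (u \<epsilon>) \<le> 1 / \<epsilon> ^ M)"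
  by (simp add: moderate_nets_def eventually_at_right_0_iff_closed)

lemma negligible_nets_iff:
  "u \<in> negligible_nets p \<longleftrightarrow> (\<forall>i. \<forall>m::nat. \<forall>\<^sub>F \<epsilon> in at_right 0. p i (u \<epsilon>) \<le> \<epsilon> ^ m)"
  by (simp add: negligible_nets_def eventually_at_right_0_iff_closed)

lemma internal_set_iff:
  "U \<in> internal_set p S \<longleftrightarrow>
    U \<in> colombeau_space p \<and> (\<exists>u\<in>U. \<forall>\<^sub>F \<epsilon> in at_right 0. u \<epsilon> \<in> S \<epsilon>)"
  by (simp add: internal_set_def eventually_at_right_0_iff)

lemma internal_setI:
  assumes "U \<in> colombeau_space p" "u \<in> U" "\<forall>\<^sub>F \<epsilon> in at_right 0. u \<epsilon> \<in> S \<epsilon>"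
  shows "U \<in> internal_set p S"
  using assms by (auto simp: internal_set_iff)

lemma internal_set_mono:
  assumes "\<And>\<epsilon>. S \<epsilon> \<subseteq> T \<epsilon>"
  shows "internal_set p S \<subseteq> internal_set p T"
  unfolding internal_set_def using assms by blast

lemma internal_internal_set: "internal p (internal_set p S)"
  by (auto simp: internal_def represents_def internal_set_def)

lemma eventually_small: "0 < b \<Longrightarrow> \<forall>\<^sub>F \<epsilon> in at_right (0::real). 0 < \<epsilon> \<and> \<epsilon> < b"
  by (auto simp: eventually_at_right_field)

text \<open>
  The arguments use homogeneity at the scalars \<open>0\<close> and \<open>-1\<close>; recording just these two
  consequences gives seminorms on abelian groups and keeps the scalar field out of the way.
\<close>

locale seminorm_family =
  fixes p :: "'i \<Rightarrow> 'e::ab_group_add \<Rightarrow> real"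
  assumes zero [simp]: "p i 0 = 0"
    and minus: "p i (- x) = p i x"
    and triangle: "p i (x + y) \<le> p i x + p i y"
begin

lemma minus_commute: "p i (x - y) = p i (y - x)"
  using minus[of i "x - y"] by simp

lemma triangle_diff: "p i (x - z) \<le> p i (x - y) + p i (y - z)"
  using triangle[of i "x - y" "y - z"] by simp

lemma zero_negligible: "(\<lambda>\<epsilon>. 0) \<in> negligible_nets p"
  unfolding negligible_nets_iff
  by (intro allI eventually_mono[OF eventually_small[OF zero_less_one]]) simp

lemma negligible_uminus: "u \<in> negligible_nets p \<Longrightarrow> (\<lambda>\<epsilon>. - u \<epsilon>) \<in> negligible_nets p"
  by (simp add: negligible_nets_iff minus)

lemma negligible_add:
  assumes "u \<in> negligible_nets p" "v \<in> negligible_nets p"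
  shows "(\<lambda>\<epsilon>. u \<epsilon> + v \<epsilon>) \<in> negligible_nets p"
  unfolding negligible_nets_iff
proof (intro allI)
  fix i and m :: nat
  have "\<forall>\<^sub>F \<epsilon> in at_right 0. p i (u \<epsilon>) \<le> \<epsilon> ^ Suc m"
    and "\<forall>\<^sub>F \<epsilon> in at_right 0. p i (v \<epsilon>) \<le> \<epsilon> ^ Suc m"
    using assms unfolding negligible_nets_iff by blast+
  moreover have "\<forall>\<^sub>F \<epsilon> in at_right (0::real). 0 < \<epsilon> \<and> \<epsilon> < 1/2" by (rule eventually_small) simp
  ultimately show "\<forall>\<^sub>F \<epsilon> in at_right 0. p i (u \<epsilon> + v \<epsilon>) \<le> \<epsilon> ^ m"
  proof eventually_elim
    case (elim \<epsilon>)
    have "p i (u \<epsilon> + v \<epsilon>) \<le> 2 * \<epsilon> * \<epsilon> ^ m" using triangle[of i "u \<epsilon>" "v \<epsilon>"] elim by simp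
    also have "\<dots> \<le> 1 * \<epsilon> ^ m" using elim by (intro mult_right_mono) auto
    finally show ?case by simp
  qed
qed

lemma moderate_add_negligible:
  assumes "u \<in> moderate_nets p" "n \<in> negligible_nets p"
  shows "(\<lambda>\<epsilon>. u \<epsilon> + n \<epsilon>) \<in> moderate_nets p"
  unfolding moderate_nets_iff
proof
  fix i
  obtain M :: nat where "\<forall>\<^sub>F \<epsilon> in at_right 0. p i (u \<epsilon>) \<le> 1 / \<epsilon> ^ M"
    using assms unfolding moderate_nets_iff by blast
  moreover have "\<forall>\<^sub>F \<epsilon> in at_right 0. p i (n \<epsilon>) \<le> \<epsilon> ^ 0"
    using assms unfolding negligible_nets_iff by blast
  moreover have "\<forall>\<^sub>F \<epsilon> in at_right (0::real). 0 < \<epsilon> \<and> \<epsilon> < 1/2" by (rule eventually_small) simp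
  ultimately have "\<forall>\<^sub>F \<epsilon> in at_right 0. p i (u \<epsilon> + n \<epsilon>) \<le> 1 / \<epsilon> ^ Suc M"
  proof eventually_elim
    case (elim \<epsilon>)
    have "1 \<le> 1 / \<epsilon> ^ M" using elim by (simp add: power_le_one)
    moreover have "p i (n \<epsilon>) \<le> 1" using elim by simp
    ultimately have "p i (u \<epsilon> + n \<epsilon>) \<le> 2 * (1 / \<epsilon> ^ M)"
      using triangle[of i "u \<epsilon>" "n \<epsilon>"] elim(1) by linarith
    also have "\<dots> \<le> 1 / \<epsilon> * (1 / \<epsilon> ^ M)"
      using elim by (intro mult_right_mono) (auto simp: field_simps)
    finally show ?case by simp
  qed
  then show "\<exists>M::nat. \<forall>\<^sub>F \<epsilon> in at_right 0. p i (u \<epsilon> + n \<epsilon>) \<le> 1 / \<epsilon> ^ M" by blast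
qed

lemma moderate_if:
  assumes "u \<in> moderate_nets p" "v \<in> moderate_nets p"
  shows "(\<lambda>\<epsilon>. if P \<epsilon> then u \<epsilon> else v \<epsilon>) \<in> moderate_nets p"
  unfolding moderate_nets_iff
proof
  fix i
  obtain M N :: nat where "\<forall>\<^sub>F \<epsilon> in at_right 0. p i (u \<epsilon>) \<le> 1 / \<epsilon> ^ M"
    and "\<forall>\<^sub>F \<epsilon> in at_right 0. p i (v \<epsilon>) \<le> 1 / \<epsilon> ^ N"
    using assms unfolding moderate_nets_iff by blast
  moreover have "\<forall>\<^sub>F \<epsilon> in at_right (0::real). 0 < \<epsilon> \<and> \<epsilon> < 1" by (rule eventually_small) simp
  ultimately have "\<forall>\<^sub>F \<epsilon> in at_right 0. p i (if P \<epsilon> then u \<epsilon> else v \<epsilon>) \<le> 1 / \<epsilon> ^ max M N"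
  proof eventually_elim
    case (elim \<epsilon>)
    have "1 / \<epsilon> ^ k \<le> 1 / \<epsilon> ^ max M N" if "k \<le> max M N" for k
      using elim that by (intro divide_left_mono power_decreasing) auto
    from this[of M] this[of N] show ?case using elim by auto
  qed
  then show "\<exists>M::nat. \<forall>\<^sub>F \<epsilon> in at_right 0. p i (if P \<epsilon> then u \<epsilon> else v \<epsilon>) \<le> 1 / \<epsilon> ^ M" by blast
qed

section \<open>Classes and representatives\<close>

lemma colombeau_rel_iff:
  assumes "u \<in> moderate_nets p"
  shows "(u, v) \<in> colombeau_rel p \<longleftrightarrow> (\<lambda>\<epsilon>. u \<epsilon> - v \<epsilon>) \<in> negligible_nets p"
proof -
  have "v \<in> moderate_nets p" if "(\<lambda>\<epsilon>. u \<epsilon> - v \<epsilon>) \<in> negligible_nets p"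
    using moderate_add_negligible[OF assms negligible_uminus[OF that]] by simp
  then show ?thesis using assms by (auto simp: colombeau_rel_def)
qed

lemma equiv_colombeau_rel: "equiv (moderate_nets p) (colombeau_rel p)"
proof (rule equivI)
  show "colombeau_rel p \<subseteq> moderate_nets p \<times> moderate_nets p"
    by (auto simp: colombeau_rel_def)
  show "refl_on (moderate_nets p) (colombeau_rel p)"
    by (auto simp: refl_on_def colombeau_rel_def zero_negligible)
  show "sym (colombeau_rel p)"
    by (rule symI) (auto simp: colombeau_rel_def dest: negligible_uminus)
  show "trans (colombeau_rel p)"
    by (rule transI) (auto simp: colombeau_rel_def dest: negligible_add)
qed

lemma class_in_colombeau_space:
  "u \<in> moderate_nets p \<Longrightarrow> colombeau_rel p `` {u} \<in> colombeau_space p"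
  by (simp add: colombeau_space_def quotientI)

lemma colombeau_space_class:
  assumes "U \<in> colombeau_space p" "u \<in> U"
  shows "u \<in> moderate_nets p" and "U = colombeau_rel p `` {u}"
  using assms equiv_colombeau_rel
  unfolding colombeau_space_def
  by (metis (no_types, lifting) Image_singleton_iff equiv_class_eq quotientE equiv_class_eq_iff)+

lemma colombeau_space_nonempty: "U \<in> colombeau_space p \<Longrightarrow> \<exists>u. u \<in> U"
  using equiv_colombeau_rel unfolding colombeau_space_def by (metis in_quotient_imp_non_empty ex_in_conv)

lemma diff_negligible_if_same_class:
  assumes "U \<in> colombeau_space p" "u \<in> U" "v \<in> U"
  shows "(\<lambda>\<epsilon>. u \<epsilon> - v \<epsilon>) \<in> negligible_nets p"
  using colombeau_space_class[OF assms(1,2)] assms(3) colombeau_rel_iff by blast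

lemma same_class_if_diff_negligible:
  assumes "U \<in> colombeau_space p" "u \<in> U" "(\<lambda>\<epsilon>. u \<epsilon> - v \<epsilon>) \<in> negligible_nets p"
  shows "v \<in> U"
  using colombeau_space_class[OF assms(1,2)] assms(3) colombeau_rel_iff by blast

lemma internal_set_inter_subset:
  "internal_set p (\<lambda>\<epsilon>. S \<epsilon> \<inter> T \<epsilon>) \<subseteq> internal_set p S \<inter> internal_set p T"
  using internal_set_mono[of "\<lambda>\<epsilon>. S \<epsilon> \<inter> T \<epsilon>" S] internal_set_mono[of "\<lambda>\<epsilon>. S \<epsilon> \<inter> T \<epsilon>" T] by blast

lemma internal_set_translate:
  assumes "n \<in> negligible_nets p"
  shows "internal_set p (\<lambda>\<epsilon>. (+) (n \<epsilon>) ` S \<epsilon>) = internal_set p S"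
proof
  have *: "internal_set p S \<subseteq> internal_set p (\<lambda>\<epsilon>. (+) (n \<epsilon>) ` S \<epsilon>)"
    if n: "n \<in> negligible_nets p" for n S
  proof
    fix U assume "U \<in> internal_set p S"
    then obtain u where U: "U \<in> colombeau_space p" "u \<in> U"
      and u: "\<forall>\<^sub>F \<epsilon> in at_right 0. u \<epsilon> \<in> S \<epsilon>"
      unfolding internal_set_iff by blast
    have "(\<lambda>\<epsilon>. n \<epsilon> + u \<epsilon>) \<in> U"
      by (rule same_class_if_diff_negligible[OF U]) (use negligible_uminus[OF n] in simp)
    moreover have "\<forall>\<^sub>F \<epsilon> in at_right 0. n \<epsilon> + u \<epsilon> \<in> (+) (n \<epsilon>) ` S \<epsilon>"
      using u by (rule eventually_mono) blast
    ultimately show "U \<in> internal_set p (\<lambda>\<epsilon>. (+) (n \<epsilon>) ` S \<epsilon>)"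
      by (rule internal_setI[OF U(1)])
  qed
  show "internal_set p S \<subseteq> internal_set p (\<lambda>\<epsilon>. (+) (n \<epsilon>) ` S \<epsilon>)" by (rule *[OF assms])
  show "internal_set p (\<lambda>\<epsilon>. (+) (n \<epsilon>) ` S \<epsilon>) \<subseteq> internal_set p S"
    using *[OF negligible_uminus[OF assms], of "\<lambda>\<epsilon>. (+) (n \<epsilon>) ` S \<epsilon>"] by (simp add: image_image)
qed

text \<open>
  Pointwise unions of representatives usually represent more than the union of the internal sets,
  because a net may alternate between the two sets. Inside a larger internal set nothing new
  arises: the part of such a net that lies in \<open>C\<^sub>\<epsilon>\<close>, filled up by a fixed net in \<open>C\<^sub>\<epsilon>\<close>, is a
  point of \<open>[C]\<close>, hence it can be moved into \<open>S\<^sub>\<epsilon>\<close> by a negligible amount. The filler is where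
  nonemptiness of \<open>[C]\<close> enters: if \<open>C\<^sub>\<epsilon>\<close> is empty for arbitrarily small \<open>\<epsilon>\<close>, then \<open>[C]\<close> is empty,
  but other \<open>C\<^sub>\<epsilon>\<close> could still add points.
\<close>

lemma internal_set_absorb:
  assumes sub: "internal_set p C \<subseteq> internal_set p S"
    and ne: "internal_set p C \<noteq> {}"
  shows "internal_set p (\<lambda>\<epsilon>. S \<epsilon> \<union> C \<epsilon>) = internal_set p S"
proof
  show "internal_set p S \<subseteq> internal_set p (\<lambda>\<epsilon>. S \<epsilon> \<union> C \<epsilon>)" by (rule internal_set_mono) blast
  show "internal_set p (\<lambda>\<epsilon>. S \<epsilon> \<union> C \<epsilon>) \<subseteq> internal_set p S"
  proof
    fix U assume "U \<in> internal_set p (\<lambda>\<epsilon>. S \<epsilon> \<union> C \<epsilon>)"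
    then obtain u where U: "U \<in> colombeau_space p" "u \<in> U"
      and u: "\<forall>\<^sub>F \<epsilon> in at_right 0. u \<epsilon> \<in> S \<epsilon> \<union> C \<epsilon>"
      unfolding internal_set_iff by blast
    obtain c where c: "c \<in> moderate_nets p" "\<forall>\<^sub>F \<epsilon> in at_right 0. c \<epsilon> \<in> C \<epsilon>"
      using ne colombeau_space_class(1) unfolding internal_set_iff ex_in_conv[symmetric] by blast
    define w where "w \<epsilon> = (if u \<epsilon> \<in> C \<epsilon> then u \<epsilon> else c \<epsilon>)" for \<epsilon>
    have w: "w \<in> moderate_nets p"
      unfolding w_def using moderate_if[OF colombeau_space_class(1)[OF U] c(1)] .
    let ?W = "colombeau_rel p `` {w}"
    have W: "?W \<in> colombeau_space p" "w \<in> ?W"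
      using w class_in_colombeau_space equiv_class_self[OF equiv_colombeau_rel] by blast+
    have "\<forall>\<^sub>F \<epsilon> in at_right 0. w \<epsilon> \<in> C \<epsilon>"
      using c(2) by (rule eventually_mono) (simp add: w_def)
    then have "?W \<in> internal_set p C" by (rule internal_setI[OF W])
    then have "?W \<in> internal_set p S" using sub by blast
    then obtain a where a: "a \<in> ?W" "\<forall>\<^sub>F \<epsilon> in at_right 0. a \<epsilon> \<in> S \<epsilon>"
      unfolding internal_set_iff by blast
    define v where "v \<epsilon> = (if u \<epsilon> \<in> C \<epsilon> then a \<epsilon> else u \<epsilon>)" for \<epsilon>
    have "(\<lambda>\<epsilon>. w \<epsilon> - a \<epsilon>) \<in> negligible_nets p"
      by (rule diff_negligible_if_same_class[OF W a(1)])
    then have "(\<lambda>\<epsilon>. u \<epsilon> - v \<epsilon>) \<in> negligible_nets p"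
      unfolding negligible_nets_iff
    proof (intro allI)
      fix i and m :: nat
      assume *: "\<forall>i. \<forall>m. \<forall>\<^sub>F \<epsilon> in at_right 0. p i (w \<epsilon> - a \<epsilon>) \<le> \<epsilon> ^ m"
      show "\<forall>\<^sub>F \<epsilon> in at_right 0. p i (u \<epsilon> - v \<epsilon>) \<le> \<epsilon> ^ m"
        using *[rule_format, of i m] eventually_small[OF zero_less_one]
        by eventually_elim (auto simp: v_def w_def split: if_splits)
    qed
    then have "v \<in> U" by (rule same_class_if_diff_negligible[OF U])
    moreover have "\<forall>\<^sub>F \<epsilon> in at_right 0. v \<epsilon> \<in> S \<epsilon>"
      using u a(2) by eventually_elim (auto simp: v_def)
    ultimately show "U \<in> internal_set p S"
      by (rule internal_setI[OF U(1)])
  qed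
qed

lemma representatives_of_intersection:
  assumes C: "represents p C (internal_set p S \<inter> internal_set p T)"
  shows "\<exists>S' T'. represents p S' (internal_set p S) \<and> represents p T' (internal_set p T)
    \<and> internal_set p (\<lambda>\<epsilon>. S' \<epsilon> \<inter> T' \<epsilon>) = internal_set p S \<inter> internal_set p T"
proof (cases "internal_set p C = {}")
  case True
  then have "internal_set p (\<lambda>\<epsilon>. S \<epsilon> \<inter> T \<epsilon>) = internal_set p S \<inter> internal_set p T"
    using C internal_set_inter_subset[of S T] by (auto simp: represents_def)
  then show ?thesis unfolding represents_def by blast
next
  case False
  let ?S = "\<lambda>\<epsilon>. S \<epsilon> \<union> C \<epsilon>" and ?T = "\<lambda>\<epsilon>. T \<epsilon> \<union> C \<epsilon>"
  have S: "internal_set p ?S = internal_set p S" and T: "internal_set p ?T = internal_set p T"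
    using C False by (auto intro!: internal_set_absorb simp: represents_def)
  have "internal_set p C \<subseteq> internal_set p (\<lambda>\<epsilon>. ?S \<epsilon> \<inter> ?T \<epsilon>)" by (rule internal_set_mono) blast
  then have "internal_set p (\<lambda>\<epsilon>. ?S \<epsilon> \<inter> ?T \<epsilon>) = internal_set p S \<inter> internal_set p T"
    using internal_set_inter_subset[of ?S ?T] C S T by (auto simp: represents_def)
  with S T show ?thesis unfolding represents_def by metis
qed

lemma eventually_seminorm_dist_le:
  assumes "U \<in> internal_set p S" "u \<in> U"
  shows "\<forall>\<^sub>F \<epsilon> in at_right 0. seminorm_dist p i (u \<epsilon>) (S \<epsilon>) \<le> ereal (\<epsilon> ^ m)"
proof -
  obtain a where a: "a \<in> U" "\<forall>\<^sub>F \<epsilon> in at_right 0. a \<epsilon> \<in> S \<epsilon>"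
    and U: "U \<in> colombeau_space p" using assms(1) unfolding internal_set_iff by blast
  have "\<forall>\<^sub>F \<epsilon> in at_right 0. p i (u \<epsilon> - a \<epsilon>) \<le> \<epsilon> ^ m"
    using diff_negligible_if_same_class[OF U assms(2) a(1)] unfolding negligible_nets_iff by blast
  with a(2) show ?thesis
    by eventually_elim (auto simp: seminorm_dist_def intro: INF_lower2)
qed

end

section \<open>Increasing sequences of seminorms\<close>

locale increasing_seminorms = seminorm_family p
  for p :: "nat \<Rightarrow> 'e::ab_group_add \<Rightarrow> real" +
  assumes mono: "m \<le> n \<Longrightarrow> p m x \<le> p n x"
begin

text \<open>
  The diagonal argument: at each \<open>\<epsilon>\<close> take the highest order at which \<open>u\<^sub>\<epsilon>\<close> can be
  approximated from \<open>S\<^sub>\<epsilon>\<close>, and an approximating point of that order. The order is capped by \<open>1/\<epsilon>\<close>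
  so that a highest one exists even where \<open>u\<^sub>\<epsilon>\<close> can be approximated to all orders; the cap
  eventually exceeds any given \<open>m\<close>.
\<close>

lemma class_in_internal_set_if_approximable:
  assumes U: "U \<in> colombeau_space p" "u \<in> U"
    and approx: "\<And>m. \<forall>\<^sub>F \<epsilon> in at_right 0. \<exists>v\<in>S \<epsilon>. p m (u \<epsilon> - v) \<le> \<epsilon> ^ m"
  shows "U \<in> internal_set p S"
proof -
  define K where
    "K \<epsilon> = {m::nat. real m \<le> 1 / \<epsilon> \<and> (\<exists>v\<in>S \<epsilon>. p m (u \<epsilon> - v) \<le> \<epsilon> ^ m)}" for \<epsilon>
  define v where "v \<epsilon> = (SOME v. v \<in> S \<epsilon> \<and> p (Max (K \<epsilon>)) (u \<epsilon> - v) \<le> \<epsilon> ^ Max (K \<epsilon>))" for \<epsilon>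
  have v: "v \<epsilon> \<in> S \<epsilon> \<and> p (Max (K \<epsilon>)) (u \<epsilon> - v \<epsilon>) \<le> \<epsilon> ^ Max (K \<epsilon>)" and Max: "m \<le> Max (K \<epsilon>)"
    if "m \<in> K \<epsilon>" for m \<epsilon>
  proof -
    have "K \<epsilon> \<subseteq> {..nat \<lfloor>1 / \<epsilon>\<rfloor>}" by (auto simp: K_def le_nat_floor)
    then have "finite (K \<epsilon>)" by (rule finite_subset) simp
    then show "m \<le> Max (K \<epsilon>)" using that by simp
    have "Max (K \<epsilon>) \<in> K \<epsilon>" using \<open>finite (K \<epsilon>)\<close> that by (intro Max_in) auto
    then have "\<exists>v. v \<in> S \<epsilon> \<and> p (Max (K \<epsilon>)) (u \<epsilon> - v) \<le> \<epsilon> ^ Max (K \<epsilon>)"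
      unfolding K_def mem_Collect_eq by blast
    then show "v \<epsilon> \<in> S \<epsilon> \<and> p (Max (K \<epsilon>)) (u \<epsilon> - v \<epsilon>) \<le> \<epsilon> ^ Max (K \<epsilon>)"
      unfolding v_def by (rule someI_ex)
  qed
  have in_K: "\<forall>\<^sub>F \<epsilon> in at_right 0. m \<in> K \<epsilon>" for m
  proof -
    have "\<forall>\<^sub>F \<epsilon> in at_right (0::real). 0 < \<epsilon> \<and> \<epsilon> < 1 / (real m + 1)"
      by (rule eventually_small) simp
    with approx[of m] show ?thesis
      by eventually_elim (auto simp: K_def field_simps)
  qed
  have "(\<lambda>\<epsilon>. u \<epsilon> - v \<epsilon>) \<in> negligible_nets p"
    unfolding negligible_nets_iff
  proof (intro allI)
    fix i m :: nat
    show "\<forall>\<^sub>F \<epsilon> in at_right 0. p i (u \<epsilon> - v \<epsilon>) \<le> \<epsilon> ^ m"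
      using in_K[of i] in_K[of m] eventually_small[OF zero_less_one]
    proof eventually_elim
      case (elim \<epsilon>)
      have "p i (u \<epsilon> - v \<epsilon>) \<le> p (Max (K \<epsilon>)) (u \<epsilon> - v \<epsilon>)" using elim by (intro mono Max)
      also have "\<dots> \<le> \<epsilon> ^ Max (K \<epsilon>)" using v elim by blast
      also have "\<dots> \<le> \<epsilon> ^ m" using elim Max[of m \<epsilon>] by (intro power_decreasing) auto
      finally show ?case .
    qed
  qed
  then have "v \<in> U" by (rule same_class_if_diff_negligible[OF U])
  moreover have "\<forall>\<^sub>F \<epsilon> in at_right 0. v \<epsilon> \<in> S \<epsilon>"
    using in_K[of 0] by (rule eventually_mono) (use v in blast)
  ultimately show ?thesis by (rule internal_setI[OF U(1)])
qed

text \<open>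
  The representative may vary with the order here, since changing it costs only a negligible
  error. That error and the infimum not being attained are paid for by passing from order \<open>m + 1\<close>
  to order \<open>m\<close>.
\<close>

lemma in_internal_set_if_dist_small:
  assumes U: "U \<in> colombeau_space p"
    and dist: "\<And>m. \<exists>w\<in>U. \<forall>\<^sub>F \<epsilon> in at_right 0. seminorm_dist p m (w \<epsilon>) (S \<epsilon>) \<le> ereal (\<epsilon> ^ m)"
  shows "U \<in> internal_set p S"
proof -
  obtain u where u: "u \<in> U" using colombeau_space_nonempty[OF U] by blast
  show ?thesis
  proof (rule class_in_internal_set_if_approximable[OF U u])
    fix m
    obtain w where w: "w \<in> U"
      and d: "\<forall>\<^sub>F \<epsilon> in at_right 0. seminorm_dist p (Suc m) (w \<epsilon>) (S \<epsilon>) \<le> ereal (\<epsilon> ^ Suc m)"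
      using dist by blast
    have "\<forall>\<^sub>F \<epsilon> in at_right 0. p (Suc m) (u \<epsilon> - w \<epsilon>) \<le> \<epsilon> ^ Suc m"
      using diff_negligible_if_same_class[OF U u w] unfolding negligible_nets_iff by blast
    moreover have "\<forall>\<^sub>F \<epsilon> in at_right (0::real). 0 < \<epsilon> \<and> \<epsilon> < 1/3" by (rule eventually_small) simp
    ultimately show "\<forall>\<^sub>F \<epsilon> in at_right 0. \<exists>v\<in>S \<epsilon>. p m (u \<epsilon> - v) \<le> \<epsilon> ^ m"
      using d
    proof eventually_elim
      case (elim \<epsilon>)
      have "seminorm_dist p (Suc m) (w \<epsilon>) (S \<epsilon>) < ereal (2 * \<epsilon> ^ Suc m)"
        using elim(2,3) by (intro le_less_trans[OF elim(3)]) simp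
      then obtain v where v: "v \<in> S \<epsilon>" "p (Suc m) (w \<epsilon> - v) < 2 * \<epsilon> ^ Suc m"
        unfolding seminorm_dist_def INF_less_iff by auto
      have "p m (u \<epsilon> - v) \<le> p (Suc m) (u \<epsilon> - v)" by (rule mono) simp
      also have "\<dots> \<le> p (Suc m) (u \<epsilon> - w \<epsilon>) + p (Suc m) (w \<epsilon> - v)" by (rule triangle_diff)
      also have "\<dots> \<le> 3 * \<epsilon> * \<epsilon> ^ m" using elim(1) v(2) by simp
      also have "\<dots> \<le> 1 * \<epsilon> ^ m" using elim(2) by (intro mult_right_mono) auto
      finally show ?case using v(1) by auto
    qed
  qed
qed

lemma inter_eq_INT_neighbourhoods:
  "internal_set p S \<inter> internal_set p T = (\<Inter>m::nat. internal_set p (\<lambda>\<epsilon>.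
     {u. seminorm_dist p m u (S \<epsilon>) \<le> ereal (\<epsilon> ^ m)}
     \<inter> {u. seminorm_dist p m u (T \<epsilon>) \<le> ereal (\<epsilon> ^ m)}))" (is "_ = (\<Inter>m. ?N m)")
proof
  show "internal_set p S \<inter> internal_set p T \<subseteq> (\<Inter>m. ?N m)"
  proof clarify
    fix U m assume ST: "U \<in> internal_set p S" "U \<in> internal_set p T"
    then have U: "U \<in> colombeau_space p" by (simp add: internal_set_iff)
    then obtain u where u: "u \<in> U" using colombeau_space_nonempty by blast
    have "\<forall>\<^sub>F \<epsilon> in at_right 0. seminorm_dist p m (u \<epsilon>) (S \<epsilon>) \<le> ereal (\<epsilon> ^ m)
        \<and> seminorm_dist p m (u \<epsilon>) (T \<epsilon>) \<le> ereal (\<epsilon> ^ m)"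
      using ST u by (intro eventually_conj eventually_seminorm_dist_le)
    then show "U \<in> ?N m" using U u unfolding internal_set_iff by auto
  qed
  show "(\<Inter>m. ?N m) \<subseteq> internal_set p S \<inter> internal_set p T"
  proof
    fix U assume N: "U \<in> (\<Inter>m. ?N m)"
    then have U: "U \<in> colombeau_space p" by (auto simp: internal_set_iff)
    have "\<exists>w\<in>U. \<forall>\<^sub>F \<epsilon> in at_right 0. seminorm_dist p m (w \<epsilon>) (S \<epsilon>) \<le> ereal (\<epsilon> ^ m)
        \<and> seminorm_dist p m (w \<epsilon>) (T \<epsilon>) \<le> ereal (\<epsilon> ^ m)" for m
      using N by (auto simp: internal_set_iff)
    then show "U \<in> internal_set p S \<inter> internal_set p T"
      using in_internal_set_if_dist_small[OF U, of S] in_internal_set_if_dist_small[OF U, of T]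
      unfolding eventually_conj_iff by blast
  qed
qed

end

lemma increasing_seminorms_if_locally_convex:
  assumes "locally_convex_incseq scale p"
  shows "increasing_seminorms p"
proof -
  from assms interpret vector_space scale by (simp add: locally_convex_incseq_def)
  have tri: "p n (x + y) \<le> p n x + p n y" and sc: "p n (scale c x) = norm c * p n x" for n x y c
    using assms by (auto simp: locally_convex_incseq_def seminorm_def)
  show ?thesis
  proof
    show "p n 0 = 0" for n using sc[of n 0 0] by simp
    show "p n (- x) = p n x" for n x using sc[of n "- 1" x] by simp
    show "p n (x + y) \<le> p n x + p n y" for n x y by (rule tri)
    show "p m x \<le> p n x" if "m \<le> n" for m n x
      using assms that by (auto simp: locally_convex_incseq_def incseq_def le_fun_def)
  qed
qed

section \<open>Dependence on the representatives\<close>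

lemma locally_convex_incseq_norm:
  "locally_convex_incseq (*) (\<lambda>n. norm :: 'k::real_normed_field \<Rightarrow> real)"
  by (auto simp: locally_convex_incseq_def seminorm_def vector_space_def incseq_def algebra_simps
      norm_mult norm_triangle_ineq)

text \<open>
  The exponent \<open>\<lfloor>1/\<epsilon>\<rfloor>\<close> is at least \<open>m\<close> once \<open>\<epsilon> \<le> 1/m\<close>, so this net decays faster than every
  power of \<open>\<epsilon>\<close> without ever vanishing.
\<close>

lemma nonvanishing_negligible_net:
  "(\<lambda>\<epsilon>. of_real (\<epsilon> ^ nat \<lfloor>1 / \<epsilon>\<rfloor>) :: 'k::real_normed_field) \<in> negligible_nets (\<lambda>n::nat. norm)"
  unfolding negligible_nets_iff
proof (intro allI)
  fix m :: nat
  have "\<forall>\<^sub>F \<epsilon> in at_right (0::real). 0 < \<epsilon> \<and> \<epsilon> < 1 / (real m + 1)"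
    by (rule eventually_small) simp
  then show "\<forall>\<^sub>F \<epsilon> in at_right 0.
      norm (of_real (\<epsilon> ^ nat \<lfloor>1 / \<epsilon>\<rfloor>) :: 'k) \<le> \<epsilon> ^ m"
  proof eventually_elim
    case (elim \<epsilon>)
    then have "\<epsilon> * (real m + 1) < 1" by (simp add: field_simps)
    moreover have "0 \<le> \<epsilon> * real m" using elim by simp
    ultimately have "\<epsilon> \<le> 1" and "\<epsilon> * real m \<le> 1"
      using elim unfolding distrib_left by linarith+
    then have "real m \<le> 1 / \<epsilon>" using elim by (simp add: field_simps)
    then have "\<epsilon> ^ nat \<lfloor>1 / \<epsilon>\<rfloor> \<le> \<epsilon> ^ m"
      using elim \<open>\<epsilon> \<le> 1\<close> by (intro power_decreasing le_nat_floor) auto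
    then show ?case using elim by (simp add: norm_power)
  qed
qed

lemma internal_set_inter_depends_on_representatives:
  "\<exists>(scale :: 'k::real_normed_field \<Rightarrow> 'k \<Rightarrow> 'k) q A B S\<^sub>1 S\<^sub>2 T\<^sub>1 T\<^sub>2.
     locally_convex_incseq scale q \<and> separating q
     \<and> internal q A \<and> internal q B
     \<and> represents q S\<^sub>1 A \<and> represents q S\<^sub>2 A
     \<and> represents q T\<^sub>1 B \<and> represents q T\<^sub>2 B
     \<and> internal_set q (\<lambda>\<epsilon>. S\<^sub>1 \<epsilon> \<inter> T\<^sub>1 \<epsilon>) \<noteq> internal_set q (\<lambda>\<epsilon>. S\<^sub>2 \<epsilon> \<inter> T\<^sub>2 \<epsilon>)"
proof -
  define q :: "nat \<Rightarrow> 'k \<Rightarrow> real" where "q = (\<lambda>n. norm)"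
  define O' :: "real \<Rightarrow> 'k set" where "O' = (\<lambda>\<epsilon>. {0})"
  define N :: "real \<Rightarrow> 'k set" where "N = (\<lambda>\<epsilon>. {of_real (\<epsilon> ^ nat \<lfloor>1 / \<epsilon>\<rfloor>)})"
  have lc: "locally_convex_incseq (*) q"
    unfolding q_def by (rule locally_convex_incseq_norm)
  interpret increasing_seminorms q
    by (rule increasing_seminorms_if_locally_convex[OF lc])
  have negligible: "(\<lambda>\<epsilon>. of_real (\<epsilon> ^ nat \<lfloor>1 / \<epsilon>\<rfloor>)) \<in> negligible_nets q"
    unfolding q_def by (rule nonvanishing_negligible_net)
  have N_rep: "internal_set q N = internal_set q O'"
    using internal_set_translate[OF negligible, of O']
    by (simp add: N_def O'_def)
  have "(\<lambda>\<epsilon>. 0) \<in> moderate_nets q"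
    unfolding moderate_nets_iff
    by (intro allI exI[of _ 0]) simp
  then have "colombeau_rel q `` {\<lambda>\<epsilon>. 0} \<in> internal_set q (\<lambda>\<epsilon>. O' \<epsilon> \<inter> O' \<epsilon>)"
    using class_in_colombeau_space equiv_class_self[OF equiv_colombeau_rel]
    by (force simp: internal_set_iff O'_def)
  moreover have "U \<notin> internal_set q (\<lambda>\<epsilon>. O' \<epsilon> \<inter> N \<epsilon>)" for U
  proof
    assume "U \<in> internal_set q (\<lambda>\<epsilon>. O' \<epsilon> \<inter> N \<epsilon>)"
    then obtain u where "\<forall>\<^sub>F \<epsilon> in at_right 0. u \<epsilon> \<in> O' \<epsilon> \<inter> N \<epsilon>"
      unfolding internal_set_iff by blast
    with eventually_small[OF zero_less_one] have "\<forall>\<^sub>F \<epsilon> in at_right (0::real). False"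
      by eventually_elim (auto simp: O'_def N_def)
    then show False by simp
  qed
  ultimately have "internal_set q (\<lambda>\<epsilon>. O' \<epsilon> \<inter> O' \<epsilon>) \<noteq> internal_set q (\<lambda>\<epsilon>. O' \<epsilon> \<inter> N \<epsilon>)" by blast
  moreover have "separating q" by (simp add: separating_def q_def)
  moreover have "internal q (internal_set q O')" by (rule internal_internal_set)
  ultimately show ?thesis
    using lc N_rep unfolding represents_def by blast
qed

section \<open>Intersections of internal sets\<close>

theorem theorem3p9:
  fixes scale :: "'k::real_normed_field \<Rightarrow> 'e::ab_group_add \<Rightarrow> 'e"
    and p :: "nat \<Rightarrow> 'e \<Rightarrow> real"
    and A B :: "(real \<Rightarrow> 'e) set set"
    and As Bs :: "real \<Rightarrow> 'e set"
  assumes "locally_convex_incseq scale p"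
    and "internal p A" and "internal p B"
    and "represents p As A" and "represents p Bs B"
  shows "internal_set p (\<lambda>\<epsilon>. As \<epsilon> \<inter> Bs \<epsilon>) \<subseteq> A \<inter> B
    \<and> (\<exists>(scale' :: 'k \<Rightarrow> 'k \<Rightarrow> 'k) q A' B' S\<^sub>1 S\<^sub>2 T\<^sub>1 T\<^sub>2.
         locally_convex_incseq scale' q \<and> separating q
         \<and> internal q A' \<and> internal q B'
         \<and> represents q S\<^sub>1 A' \<and> represents q S\<^sub>2 A'
         \<and> represents q T\<^sub>1 B' \<and> represents q T\<^sub>2 B'
         \<and> internal_set q (\<lambda>\<epsilon>. S\<^sub>1 \<epsilon> \<inter> T\<^sub>1 \<epsilon>) \<noteq> internal_set q (\<lambda>\<epsilon>. S\<^sub>2 \<epsilon> \<inter> T\<^sub>2 \<epsilon>))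
    \<and> A \<inter> B = (\<Inter>m::nat. internal_set p (\<lambda>\<epsilon>.
         {u. seminorm_dist p m u (As \<epsilon>) \<le> ereal (\<epsilon> ^ m)}
         \<inter> {u. seminorm_dist p m u (Bs \<epsilon>) \<le> ereal (\<epsilon> ^ m)}))
    \<and> (internal p (A \<inter> B) \<and> (\<exists>C. represents p C (A \<inter> B) \<and> sharply_bounded p C)
       \<longrightarrow> (\<exists>As' Bs'. represents p As' A \<and> represents p Bs' B
              \<and> internal_set p (\<lambda>\<epsilon>. As' \<epsilon> \<inter> Bs' \<epsilon>) = A \<inter> B))"
proof -
  interpret increasing_seminorms p
    by (rule increasing_seminorms_if_locally_convex[OF assms(1)])
  have A: "A = internal_set p As" and B: "B = internal_set p Bs"
    using assms by (simp_all add: represents_def)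
  show ?thesis
    unfolding A B
    by (intro conjI impI internal_set_inter_subset internal_set_inter_depends_on_representatives
        inter_eq_INT_neighbourhoods)
      (blast intro: representatives_of_intersection)
qed

end
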